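(* If an HH continued fraction with coefficients $(\alpha_i,\beta_i)_{i\in\mathbb Z}$ is doubly symmetric, then it is periodic. Moreover: (A) If it is even symmetric with respect to $\alpha_m$ and $\alpha_n$ with $n<m$, then it is periodic with period $2(m-n)$. (B) If it is odd symmetric with respect to $\beta_m$ and $\beta_n$ with $n<m$, then it is periodic with period $2(m-n)$. (C) If it is even symmetric with respect to $\alpha_n$ and odd symmetric with respect to $\beta_m$, then it is periodic with period $2(n-m)+1$ in the case $m\le n$, and with period $2(m-n)-1$ in the case $m>n$.
   Context: Work over $\mathbb C$. Let $g\ge 1$, let $X$ be a polynomial in $x$ of degree $2g+2$ that is not the square of a polynomial, and let $\epsilon\in\mathbb C$ with $X(\epsilon)\ne 0$. Put $s=x-\epsilon$ and $S(s)=X(\epsilon+s)$. Fix a square root of $X(\epsilon)$ and let $\sqrt X$ be the analytic branch near $s=0$ with this value at $s=0$. A (regular) two-sided HH (hyperelliptic Halphen) development is a sequence $(t_i,A^{(i)})_{i\in\mathbb Z}$, with $t_i\in\mathbb C\setminus\{0\}$ and $A^{(i)}\in\mathbb C[s]$ of degree at most $g+1$, such that for every $i$: $A^{(i)}\equiv\sqrt X \pmod{s^{g+1}}$; $S-(A^{(i)})^2=s^{g+1}(s-t_i)B^{(i)}$ with $B^{(i)}$ a polynomial of degree exactly $g$ with no root equal to $0$; $B^{(i)}(t_{i+1})=0$; and $A^{(i)}(t_{i+1})=-A^{(i+1)}(t_{i+1})$. The coefficients of the associated HH continued fraction are, for $i\in\mathbb Z$, $$\alpha_i=\frac{A^{(i-1)}(s)-A^{(i-1)}(t_i)}{s-t_i}+\frac{A^{(i)}(s)-A^{(i)}(t_i)}{s-t_i},\qquad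 \beta_i=\frac{s^{g+1}B^{(i-1)}(s)}{s-t_i}.$$ The HH continued fraction is: - periodic with period $p$ ($p\geq1$) if $\alpha_r=\alpha_s$ and $\beta_r=\beta_s$ whenever $r\equiv s\pmod p$ ($p$ need not be minimal); - even symmetric with respect to $\alpha_n$ if $\alpha_{n-i}=\alpha_{n+i}$ and $\beta_{n-i}=\beta_{n+i+1}$ for all $i\in\mathbb Z$; - odd symmetric with respect to $\beta_n$ if $\alpha_{n-i}=\alpha_{n+i-1}$ and $\beta_{n-i}=\beta_{n+i}$ for all $i\in\mathbb Z$; - doubly symmetric if it is symmetric (even or odd) with respect to two different centres, where centres are of the form $\alpha_n$ (even symmetry) or $\beta_n$ (odd symmetry), distinguished by their type and index. *)

theory Defs
  imports
    "HOL-Complex_Analysis.Complex_Analysis"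
    "HOL-Computational_Algebra.Computational_Algebra"
    "HOL-Number_Theory.Cong"
begin

text \<open>
  All polynomials are written in the local variable $s = x - \epsilon$; \<open>shifted\<close> is
  $S(s) = X(\epsilon + s)$.
\<close>

definition shifted :: "complex poly \<Rightarrow> complex \<Rightarrow> complex poly" where
  "shifted X \<epsilon> = pcompose X [:\<epsilon>, 1:]"

definition sqrt_branch :: "complex poly \<Rightarrow> complex \<Rightarrow> (complex \<Rightarrow> complex) \<Rightarrow> bool" where
  "sqrt_branch S w f \<longleftrightarrow>
     f analytic_on {0} \<and> f 0 = w \<and> (\<forall>\<^sub>F s in nhds 0. (f s)\<^sup>2 = poly S s)"

text \<open>
  The polynomials $B^{(i)}$ are uniquely determined by $t_i$ and $A^{(i)}$ through the second
  conjunct about \<open>A i\<close>; they are kept as an explicit argument because the coefficients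
  $\beta_i$ refer to them. The congruence modulo $s^{g+1}$ is divisibility in the ring of
  formal power series, applied to the Taylor series at $0$.
\<close>

definition hh_development ::
  "nat \<Rightarrow> complex poly \<Rightarrow> (complex \<Rightarrow> complex) \<Rightarrow> (int \<Rightarrow> complex) \<Rightarrow>
   (int \<Rightarrow> complex poly) \<Rightarrow> (int \<Rightarrow> complex poly) \<Rightarrow> bool" where
  "hh_development g S f t A B \<longleftrightarrow>
     (\<forall>i. t i \<noteq> 0 \<and>
          degree (A i) \<le> g + 1 \<and>
          fps_X ^ (g + 1) dvd (fps_of_poly (A i) - fps_expansion f 0) \<and>
          S - (A i)\<^sup>2 = monom 1 (g + 1) * [:- t i, 1:] * B i \<and>
          degree (B i) = g \<and>
          poly (B i) 0 \<noteq> 0 \<and>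
          poly (B i) (t (i + 1)) = 0 \<and>
          poly (A i) (t (i + 1)) = - poly (A (i + 1)) (t (i + 1)))"

text \<open>
  The quotients below are polynomial divisions by $s - t_i$. They are exact:
  see \<open>hh_alpha_exact\<close> and \<open>hh_beta_exact\<close>.
\<close>

definition hh_alpha ::
  "(int \<Rightarrow> complex) \<Rightarrow> (int \<Rightarrow> complex poly) \<Rightarrow> int \<Rightarrow> complex poly" where
  "hh_alpha t A i =
     (A (i - 1) - [:poly (A (i - 1)) (t i):]) div [:- t i, 1:]
     + (A i - [:poly (A i) (t i):]) div [:- t i, 1:]"

definition hh_beta ::
  "nat \<Rightarrow> (int \<Rightarrow> complex) \<Rightarrow> (int \<Rightarrow> complex poly) \<Rightarrow> int \<Rightarrow> complex poly" where
  "hh_beta g t B i = (monom 1 (g + 1) * B (i - 1)) div [:- t i, 1:]"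

lemma hh_alpha_exact:
  "[:- t i, 1:] * hh_alpha t A i =
     (A (i - 1) - [:poly (A (i - 1)) (t i):]) + (A i - [:poly (A i) (t i):])"
proof -
  have "[:- c, 1:] dvd (p - [:poly p c:])" for c :: complex and p
    by (simp flip: poly_eq_0_iff_dvd)
  then show ?thesis
    by (simp add: hh_alpha_def distrib_left del: mult_pCons_left)
qed

lemma hh_beta_exact:
  assumes "hh_development g S f t A B"
  shows "[:- t i, 1:] * hh_beta g t B i = monom 1 (g + 1) * B (i - 1)"
proof -
  have "poly (B (i - 1)) (t (i - 1 + 1)) = 0"
    using assms unfolding hh_development_def by blast
  then have "[:- t i, 1:] dvd monom 1 (g + 1) * B (i - 1)"
    by (simp flip: poly_eq_0_iff_dvd)
  then show ?thesis
    by (simp add: hh_beta_def del: mult_pCons_left)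
qed

definition hh_periodic :: "(int \<Rightarrow> 'a) \<Rightarrow> (int \<Rightarrow> 'a) \<Rightarrow> int \<Rightarrow> bool" where
  "hh_periodic \<alpha> \<beta> p \<longleftrightarrow>
     p \<ge> 1 \<and> (\<forall>r s. [r = s] (mod p) \<longrightarrow> \<alpha> r = \<alpha> s \<and> \<beta> r = \<beta> s)"

definition even_symmetric :: "(int \<Rightarrow> 'a) \<Rightarrow> (int \<Rightarrow> 'a) \<Rightarrow> int \<Rightarrow> bool" where
  "even_symmetric \<alpha> \<beta> n \<longleftrightarrow>
     (\<forall>i. \<alpha> (n - i) = \<alpha> (n + i) \<and> \<beta> (n - i) = \<beta> (n + i + 1))"

definition odd_symmetric :: "(int \<Rightarrow> 'a) \<Rightarrow> (int \<Rightarrow> 'a) \<Rightarrow> int \<Rightarrow> bool" where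
  "odd_symmetric \<alpha> \<beta> n \<longleftrightarrow>
     (\<forall>i. \<alpha> (n - i) = \<alpha> (n + i - 1) \<and> \<beta> (n - i) = \<beta> (n + i))"

datatype centre = AlphaCentre int | BetaCentre int

fun symmetric_about :: "(int \<Rightarrow> 'a) \<Rightarrow> (int \<Rightarrow> 'a) \<Rightarrow> centre \<Rightarrow> bool" where
  "symmetric_about \<alpha> \<beta> (AlphaCentre n) = even_symmetric \<alpha> \<beta> n"
| "symmetric_about \<alpha> \<beta> (BetaCentre n) = odd_symmetric \<alpha> \<beta> n"

definition doubly_symmetric :: "(int \<Rightarrow> 'a) \<Rightarrow> (int \<Rightarrow> 'a) \<Rightarrow> bool" where
  "doubly_symmetric \<alpha> \<beta> \<longleftrightarrow>
     (\<exists>c c'. c \<noteq> c' \<and> symmetric_about \<alpha> \<beta> c \<and> symmetric_about \<alpha> \<beta> c')"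

end

theory Submission
  imports Defs
begin

text \<open>
  Both kinds of symmetry are reflections \<open>j \<mapsto> k - j\<close> of the indices of \<open>\<alpha>\<close>, coupled with
  \<open>j \<mapsto> k + 1 - j\<close> for \<open>\<beta>\<close>: here \<open>k = 2 * n\<close> for the centre \<open>\<alpha>\<^sub>n\<close> and \<open>k = 2 * n - 1\<close> for the
  centre \<open>\<beta>\<^sub>n\<close>. Distinct centres have distinct \<open>k\<close>, and composing the reflections for \<open>k < l\<close>
  translates both sequences by \<open>l - k\<close>.
\<close>

definition reflective :: "(int \<Rightarrow> 'a) \<Rightarrow> (int \<Rightarrow> 'a) \<Rightarrow> int \<Rightarrow> bool" where
  "reflective \<alpha> \<beta> k \<longleftrightarrow> (\<forall>j. \<alpha> (k - j) = \<alpha> j \<and> \<beta> (k + 1 - j) = \<beta> j)"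

text \<open>The offset \<open>i\<close> and the index \<open>j = n - i\<close> determine each other,
  so this is a change of variable: \<open>n + i = 2 * n - j\<close>, and the extra 1 in the \<beta>
  clause is the one built into \<open>reflective\<close>.\<close>

lemma even_symmetric_iff_reflective:
  "even_symmetric \<alpha> \<beta> n \<longleftrightarrow> reflective \<alpha> \<beta> (2 * n)"
proof
  assume "even_symmetric \<alpha> \<beta> n"
  then have "\<alpha> (n - (n - j)) = \<alpha> (n + (n - j)) \<and> \<beta> (n - (n - j)) = \<beta> (n + (n - j) + 1)" for j
    unfolding even_symmetric_def by blast
  then show "reflective \<alpha> \<beta> (2 * n)"
    by (simp add: reflective_def algebra_simps)
next
  assume "reflective \<alpha> \<beta> (2 * n)"
  then have "\<alpha> (2 * n - (n - i)) = \<alpha> (n - i) \<and> \<beta> (2 * n + 1 - (n - i)) = \<beta> (n - i)" for i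
    unfolding reflective_def by blast
  then show "even_symmetric \<alpha> \<beta> n"
    by (simp add: even_symmetric_def algebra_simps)
qed

text \<open>Again \<open>j = n - i\<close>. Now \<beta> is reflected about \<open>n\<close> itself,
  so \<open>k + 1 = 2 * n\<close>, and \<alpha> about the half-integer
  \<open>n - 1/2\<close>.\<close>

lemma odd_symmetric_iff_reflective:
  "odd_symmetric \<alpha> \<beta> n \<longleftrightarrow> reflective \<alpha> \<beta> (2 * n - 1)"
proof
  assume "odd_symmetric \<alpha> \<beta> n"
  then have "\<alpha> (n - (n - j)) = \<alpha> (n + (n - j) - 1) \<and> \<beta> (n - (n - j)) = \<beta> (n + (n - j))" for j
    unfolding odd_symmetric_def by blast
  then show "reflective \<alpha> \<beta> (2 * n - 1)"
    by (simp add: reflective_def algebra_simps)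
next
  assume "reflective \<alpha> \<beta> (2 * n - 1)"
  then have "\<alpha> (2 * n - 1 - (n - i)) = \<alpha> (n - i) \<and> \<beta> (2 * n - 1 + 1 - (n - i)) = \<beta> (n - i)" for i
    unfolding reflective_def by blast
  then show "odd_symmetric \<alpha> \<beta> n"
    by (simp add: odd_symmetric_def algebra_simps)
qed

lemma translation_invariant_imp_cong_eq:
  fixes u :: "int \<Rightarrow> 'a"
  assumes step: "\<And>j. u (j + p) = u j" and "[r = s] (mod p)"
  shows "u r = u s"
proof -
  \<comment> \<open>The multiplier \<open>k\<close> may be negative, so the induction runs from 0 in
    both directions; the downward case reads \<open>step\<close> backwards.\<close>
  have mult: "u (j + k * p) = u j" for j k
  proof (induction k rule: int_induct[where k = 0])
    case (step1 i)
    then show ?case using step[of "j + i * p"] by (simp add: algebra_simps)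
  next
    case (step2 i)
    then show ?case using step[of "j + (i - 1) * p"] by (simp add: algebra_simps)
  qed simp
  obtain k where "s = r + k * p"
    using assms(2) by (auto simp: cong_iff_lin mult.commute)
  then show ?thesis by (simp add: mult)
qed

lemma reflective_imp_periodic:
  assumes "reflective \<alpha> \<beta> k" "reflective \<alpha> \<beta> l" "k < l"
  shows "hh_periodic \<alpha> \<beta> (l - k)"
proof -
  have refl: "\<alpha> (k - j) = \<alpha> j" "\<beta> (k + 1 - j) = \<beta> j"
    "\<alpha> (l - j) = \<alpha> j" "\<beta> (l + 1 - j) = \<beta> j" for j
    using assms(1,2) unfolding reflective_def by blast+
  \<comment> \<open>Reflect by \<open>k\<close>, then by \<open>l\<close>. For \<beta> the two added
    ones cancel, so both sequences are translated by the same amount \<open>l - k\<close>.\<close>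
  have "\<alpha> (l - (k - j)) = \<alpha> j" "\<beta> (l + 1 - (k + 1 - j)) = \<beta> j" for j
    by (simp_all only: refl)
  then have "\<alpha> (j + (l - k)) = \<alpha> j" "\<beta> (j + (l - k)) = \<beta> j" for j
    by (simp_all add: algebra_simps)
  then have "\<alpha> r = \<alpha> s" "\<beta> r = \<beta> s" if "[r = s] (mod (l - k))" for r s
    using that by (blast intro: translation_invariant_imp_cong_eq)+
  then show ?thesis
    using assms(3) by (auto simp only: hh_periodic_def int_one_le_iff_zero_less diff_gt_0_iff_gt)
qed

lemma doubly_symmetric_imp_periodic:
  assumes "doubly_symmetric \<alpha> \<beta>"
  shows "\<exists>p. hh_periodic \<alpha> \<beta> p"
proof -
  \<comment> \<open>\<open>h c\<close> is twice the point about which the indices of \<alpha> are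
    reflected.\<close>
  define h where "h c = (case c of AlphaCentre n \<Rightarrow> 2 * n | BetaCentre n \<Rightarrow> 2 * n - 1)" for c
  have h: "reflective \<alpha> \<beta> (h c)" if "symmetric_about \<alpha> \<beta> c" for c
    using that by (cases c)
      (simp_all add: h_def even_symmetric_iff_reflective odd_symmetric_iff_reflective)
  obtain c c' where "c \<noteq> c'" "symmetric_about \<alpha> \<beta> c" "symmetric_about \<alpha> \<beta> c'"
    using assms unfolding doubly_symmetric_def by blast
  \<comment> \<open>Centres of one type differ in their index; centres of different types are
    separated by the parity of \<open>h\<close>.\<close>
  moreover have "h c \<noteq> h c'" if "c \<noteq> c'" for c c'
    using that by (cases c; cases c'; simp add: h_def; presburger)
  ultimately have "h c < h c' \<or> h c' < h c" "reflective \<alpha> \<beta> (h c)" "reflective \<alpha> \<beta> (h c')"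
    using h by (auto simp: neq_iff)
  then show ?thesis
    using reflective_imp_periodic by blast
qed

theorem proposition8:
  fixes g :: nat and X S :: "complex poly" and \<epsilon> w :: complex
    and f :: "complex \<Rightarrow> complex" and t :: "int \<Rightarrow> complex"
    and A B \<alpha> \<beta> :: "int \<Rightarrow> complex poly"
  assumes "g \<ge> 1"
    and "degree X = 2 * g + 2"
    and "\<not> (\<exists>q. X = q\<^sup>2)"
    and "poly X \<epsilon> \<noteq> 0"
    and "S = shifted X \<epsilon>"
    and "w\<^sup>2 = poly X \<epsilon>"
    and "sqrt_branch S w f"
    and "hh_development g S f t A B"
    and "\<alpha> = hh_alpha t A"
    and "\<beta> = hh_beta g t B"
  shows "(doubly_symmetric \<alpha> \<beta> \<longrightarrow> (\<exists>p. hh_periodic \<alpha> \<beta> p))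
    \<and> (\<forall>m n. n < m \<and> even_symmetric \<alpha> \<beta> m \<and> even_symmetric \<alpha> \<beta> n
          \<longrightarrow> hh_periodic \<alpha> \<beta> (2 * (m - n)))
    \<and> (\<forall>m n. n < m \<and> odd_symmetric \<alpha> \<beta> m \<and> odd_symmetric \<alpha> \<beta> n
          \<longrightarrow> hh_periodic \<alpha> \<beta> (2 * (m - n)))
    \<and> (\<forall>m n. even_symmetric \<alpha> \<beta> n \<and> odd_symmetric \<alpha> \<beta> m
          \<longrightarrow> (m \<le> n \<longrightarrow> hh_periodic \<alpha> \<beta> (2 * (n - m) + 1))
            \<and> (m > n \<longrightarrow> hh_periodic \<alpha> \<beta> (2 * (m - n) - 1)))"
proof (intro conjI allI impI)
  show "\<exists>p. hh_periodic \<alpha> \<beta> p" if "doubly_symmetric \<alpha> \<beta>"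
    using that by (rule doubly_symmetric_imp_periodic)
next
  fix m n :: int
  assume "n < m \<and> even_symmetric \<alpha> \<beta> m \<and> even_symmetric \<alpha> \<beta> n"
  then show "hh_periodic \<alpha> \<beta> (2 * (m - n))"
    using reflective_imp_periodic[of \<alpha> \<beta> "2 * n" "2 * m"]
    by (simp add: even_symmetric_iff_reflective algebra_simps)
next
  fix m n :: int
  assume "n < m \<and> odd_symmetric \<alpha> \<beta> m \<and> odd_symmetric \<alpha> \<beta> n"
  then show "hh_periodic \<alpha> \<beta> (2 * (m - n))"
    \<comment> \<open>The half-step offsets of the two centres cancel in the difference.\<close>
    using reflective_imp_periodic[of \<alpha> \<beta> "2 * n - 1" "2 * m - 1"]
    by (simp add: odd_symmetric_iff_reflective algebra_simps)
next
  fix m n :: int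
  assume "even_symmetric \<alpha> \<beta> n \<and> odd_symmetric \<alpha> \<beta> m" and "m \<le> n"
  \<comment> \<open>Here the odd centre comes first: \<open>m \<le> n\<close> already gives
    \<open>2 * m - 1 < 2 * n\<close>, so \<open>m = n\<close> is allowed and yields period
    1.\<close>
  then show "hh_periodic \<alpha> \<beta> (2 * (n - m) + 1)"
    using reflective_imp_periodic[of \<alpha> \<beta> "2 * m - 1" "2 * n"]
    by (simp add: even_symmetric_iff_reflective odd_symmetric_iff_reflective algebra_simps)
next
  fix m n :: int
  assume "even_symmetric \<alpha> \<beta> n \<and> odd_symmetric \<alpha> \<beta> m" and "m > n"
  \<comment> \<open>The order is reversed: for integers \<open>m > n\<close> gives
    \<open>2 * n < 2 * m - 1\<close>, so the period is at least 1.\<close>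
  then show "hh_periodic \<alpha> \<beta> (2 * (m - n) - 1)"
    using reflective_imp_periodic[of \<alpha> \<beta> "2 * n" "2 * m - 1"]
    by (simp add: even_symmetric_iff_reflective odd_symmetric_iff_reflective algebra_simps)
qed

end
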